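(* Let $X\subset\mathbb{C}^m$ be an unbounded algebraic set of pure dimension $k$. Let $W\subset\mathbb{C}^m$ be an $(m-k)$-dimensional complex vector subspace with $W\cap C_{3,\infty}(X)=\{0\}$, let $V$ be the orthogonal complement of $W$, use coordinates $(x,y)\in V\times W=\mathbb{C}^m$, and let $\pi:X\to V$ be the restriction to $X$ of the canonical projection $(x,y)\mapsto x$. Suppose that $C_{4,\infty}(X)\cap W=\{0\}$. Then there exists a sufficiently large $R>0$ such that $$\mathrm{Sing}\,X\setminus\bar B_R=\mathrm{Sing}\,\pi\setminus\bar B_R .$$
   Context: Let $X\subset\mathbb{C}^m$ be an unbounded pure $k$-dimensional (complex, closed) algebraic set, $\mathrm{Sing}\,X$ its set of singular points, and $T_pX$ the complex tangent space at $p\in X\setminus\mathrm{Sing}\,X$, viewed as a linear subspace of $\mathbb{C}^m$. - $C_{3,\infty}(X)$ is the set of $v\in\mathbb{C}^m$ for which there exist sequences $(p_j)_j$ in $X$ and $(t_j)_j$ in $\mathbb{C}$ with $\lim_{j\to\infty}\|p_j\|=\infty$ and $\lim_{j\to\infty}t_jp_j=v$. - $C_{4,\infty}(X)$ is the set of $v\in\mathbb{C}^m$ for which there exist a sequence $(p_j)_j$ in $X\setminus\mathrm{Sing}\,X$ and vectors $v_j\in T_{p_j}X$ with $\lim_{j\to\infty}\|p_j\|=\infty$ and $\lim_{j\to\infty}v_j=v$. $B_R$ denotes the ball in $\mathbb{C}^m$ of radius $R$ centered at the origin and $\bar B_R$ its closure. $\mathrm{Sing}\,\pi\subset X$ denotes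 the singular (critical) locus of $\pi$: the set of points of $\mathrm{Sing}\,X$ together with the points $p\in X\setminus\mathrm{Sing}\,X$ at which the differential $d_p\pi:T_pX\to V$ is not an isomorphism. *)

theory Defs
  imports "HOL-Analysis.Analysis" "HOL-Library.Extended_Nat"
begin

text \<open>
  Complex linear algebra in \<open>complex ^ 'm\<close> is that of the library interpretation \<open>vec\<close>
  (scalar multiplication \<open>*s\<close>), so \<open>vec.subspace\<close> and \<open>vec.dim\<close> refer to the
  scalar field \<open>complex\<close>, whereas \<open>subspace\<close> and \<open>dim\<close> would be over the reals.
\<close>

subsection \<open>Algebraic sets and their dimension\<close>

text \<open>Polynomials are identified with the functions they induce, as the field is infinite.\<close>

inductive_set poly_funs :: "(complex ^ 'm \<Rightarrow> complex) set" where
  const: "(\<lambda>z. c) \<in> poly_funs"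
| coord: "(\<lambda>z. z $ i) \<in> poly_funs"
| add: "f \<in> poly_funs \<Longrightarrow> g \<in> poly_funs \<Longrightarrow> (\<lambda>z. f z + g z) \<in> poly_funs"
| mult: "f \<in> poly_funs \<Longrightarrow> g \<in> poly_funs \<Longrightarrow> (\<lambda>z. f z * g z) \<in> poly_funs"

definition zero_locus :: "(complex ^ 'm \<Rightarrow> complex) set \<Rightarrow> (complex ^ 'm) set" where
  "zero_locus F = {z. \<forall>f\<in>F. f z = 0}"

definition algebraic_set :: "(complex ^ 'm) set \<Rightarrow> bool" where
  "algebraic_set X \<longleftrightarrow> (\<exists>F\<subseteq>poly_funs. X = zero_locus F)"

definition irreducible_set :: "(complex ^ 'm) set \<Rightarrow> bool" where
  "irreducible_set Y \<longleftrightarrow> algebraic_set Y \<and> Y \<noteq> {} \<and>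
     (\<forall>A B. algebraic_set A \<longrightarrow> algebraic_set B \<longrightarrow> Y = A \<union> B \<longrightarrow> A = Y \<or> B = Y)"

definition irreducible_components :: "(complex ^ 'm) set \<Rightarrow> (complex ^ 'm) set set" where
  "irreducible_components X =
     {Y. irreducible_set Y \<and> Y \<subseteq> X \<and> (\<forall>Z. irreducible_set Z \<longrightarrow> Y \<subseteq> Z \<longrightarrow> Z \<subseteq> X \<longrightarrow> Z = Y)}"

text \<open>Krull dimension of \<open>X\<close> in the Zariski topology. Values in \<open>enat\<close> make the supremum meaningful
  without a prior bound on the lengths of chains.\<close>

definition alg_dim :: "(complex ^ 'm) set \<Rightarrow> enat" where
  "alg_dim X = (SUP n \<in> {n. \<exists>Z :: nat \<Rightarrow> (complex ^ 'm) set.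
      (\<forall>i\<le>n. irreducible_set (Z i) \<and> Z i \<subseteq> X) \<and> (\<forall>i<n. Z i \<subset> Z (Suc i))}. enat n)"

definition pure_dimensional :: "nat \<Rightarrow> (complex ^ 'm) set \<Rightarrow> bool" where
  "pure_dimensional k X \<longleftrightarrow> (\<forall>Y\<in>irreducible_components X. alg_dim Y = enat k)"

definition local_dim :: "(complex ^ 'm) set \<Rightarrow> complex ^ 'm \<Rightarrow> enat" where
  "local_dim X p = (SUP Y \<in> {Y \<in> irreducible_components X. p \<in> Y}. alg_dim Y)"

subsection \<open>Tangent spaces and singular points\<close>

definition vanishing_ideal :: "(complex ^ 'm) set \<Rightarrow> (complex ^ 'm \<Rightarrow> complex) set" where
  "vanishing_ideal X = {f \<in> poly_funs. \<forall>z\<in>X. f z = 0}"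

text \<open>The tangent space is translated to the origin. At an arbitrary point of \<open>X\<close> this is
  the Zariski tangent space; at a regular point it is the tangent space of the complex manifold.\<close>

definition tangent_space :: "(complex ^ 'm) set \<Rightarrow> complex ^ 'm \<Rightarrow> (complex ^ 'm) set" where
  "tangent_space X p = {v. \<forall>f\<in>vanishing_ideal X. frechet_derivative f (at p) v = 0}"

text \<open>A point is regular if the Zariski tangent space has the dimension of \<open>X\<close> at that point.\<close>

definition Sing :: "(complex ^ 'm) set \<Rightarrow> (complex ^ 'm) set" where
  "Sing X = {p \<in> X. enat (vec.dim (tangent_space X p)) \<noteq> local_dim X p}"

subsection \<open>Tangent cones at infinity\<close>

definition C3_inf :: "(complex ^ 'm) set \<Rightarrow> (complex ^ 'm) set" where
  "C3_inf X = {v. \<exists>(p :: nat \<Rightarrow> complex ^ 'm) (t :: nat \<Rightarrow> complex).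
     (\<forall>j. p j \<in> X) \<and>
     filterlim (\<lambda>j. norm (p j)) at_top sequentially \<and>
     (\<lambda>j. t j *s p j) \<longlonglongrightarrow> v}"

definition C4_inf :: "(complex ^ 'm) set \<Rightarrow> (complex ^ 'm) set" where
  "C4_inf X = {v. \<exists>(p :: nat \<Rightarrow> complex ^ 'm) (u :: nat \<Rightarrow> complex ^ 'm).
     (\<forall>j. p j \<in> X - Sing X \<and> u j \<in> tangent_space X (p j)) \<and>
     filterlim (\<lambda>j. norm (p j)) at_top sequentially \<and>
     u \<longlonglongrightarrow> v}"

subsection \<open>Orthogonal complements, projections, critical loci\<close>

definition hermitian_inner :: "complex ^ 'm \<Rightarrow> complex ^ 'm \<Rightarrow> complex" where
  "hermitian_inner x y = (\<Sum>i\<in>UNIV. x $ i * cnj (y $ i))"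

definition hermitian_complement :: "(complex ^ 'm) set \<Rightarrow> (complex ^ 'm) set" where
  "hermitian_complement W = {x. \<forall>w\<in>W. hermitian_inner x w = 0}"

text \<open>The projection \<open>(x, y) \<mapsto> x\<close> of the direct sum of \<open>V\<close> and \<open>W\<close>; meaningful only
  if \<open>V\<close> and \<open>W\<close> are complementary subspaces.\<close>

definition proj_along :: "(complex ^ 'm) set \<Rightarrow> (complex ^ 'm) set \<Rightarrow> complex ^ 'm \<Rightarrow> complex ^ 'm" where
  "proj_along V W z = (THE x. x \<in> V \<and> (\<exists>y\<in>W. z = x + y))"

text \<open>The singular locus of the restriction to \<open>X\<close> of a holomorphic map \<open>f\<close> on the ambient space
  sending \<open>X\<close> into the linear subspace \<open>V\<close>. The differential at \<open>p\<close> of the restriction is that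
  of \<open>f\<close>, restricted to the tangent space; being linear, it is an isomorphism onto \<open>V\<close> iff it is
  bijective.\<close>

definition Sing_map ::
    "(complex ^ 'm) set \<Rightarrow> (complex ^ 'm) set \<Rightarrow> (complex ^ 'm \<Rightarrow> complex ^ 'm) \<Rightarrow> (complex ^ 'm) set" where
  "Sing_map X V f = Sing X \<union>
     {p \<in> X - Sing X. \<not> bij_betw (frechet_derivative f (at p)) (tangent_space X p) V}"

end

theory Submission
  imports Defs
begin

text \<open>
  If the conclusion fails, there are regular points \<open>p\<^sub>j\<close> tending to infinity at which
  \<open>d\<pi>\<close> is not an isomorphism. As \<open>X\<close> has pure dimension \<open>k\<close>, the tangent space at \<open>p\<^sub>j\<close> has the
  dimension of \<open>V\<close>, so the kernel of \<open>d\<pi>\<close>, which is its intersection with \<open>W\<close>,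
  contains a unit vector \<open>u\<^sub>j\<close>. A limit point of the \<open>u\<^sub>j\<close> is a unit vector in both \<open>W\<close> and
  \<open>C4_inf X\<close>, a contradiction.
\<close>

section \<open>Zariski closure, irreducible components and local dimension\<close>

lemma algebraic_set_Int:
  assumes "algebraic_set A" "algebraic_set B"
  shows "algebraic_set (A \<inter> B)"
proof -
  obtain F G where "F \<subseteq> poly_funs" "A = zero_locus F" "G \<subseteq> poly_funs" "B = zero_locus G"
    using assms by (auto simp: algebraic_set_def)
  then have "F \<union> G \<subseteq> poly_funs" "A \<inter> B = zero_locus (F \<union> G)"
    by (auto simp: zero_locus_def)
  then show ?thesis unfolding algebraic_set_def by blast
qed

lemma algebraic_set_singleton: "algebraic_set {p :: complex ^ 'm}"
proof -
  let ?F = "range (\<lambda>i (z :: complex ^ 'm). z $ i + (- (p $ i)))"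
  have "?F \<subseteq> poly_funs"
    using poly_funs.add[OF poly_funs.coord poly_funs.const] by blast
  moreover have "{p} = zero_locus ?F"
    by (auto simp: zero_locus_def vec_eq_iff)
  ultimately show ?thesis unfolding algebraic_set_def by blast
qed

lemma irreducible_set_singleton: "irreducible_set {p :: complex ^ 'm}"
proof -
  have "A = {p} \<or> B = {p}" if "{p} = A \<union> B" for A B
    using that by (metis Un_singleton_iff)
  then show ?thesis by (simp add: irreducible_set_def algebraic_set_singleton)
qed

text \<open>\<open>zero_locus (vanishing_ideal U)\<close> is the Zariski closure of
  \<open>U\<close>. It is needed because the union of a chain of algebraic sets need not be
  algebraic.\<close>

lemma algebraic_set_Zariski_closure: "algebraic_set (zero_locus (vanishing_ideal U))"
proof -
  have "vanishing_ideal U \<subseteq> poly_funs" unfolding vanishing_ideal_def by (rule Collect_subset)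
  then show ?thesis unfolding algebraic_set_def by blast
qed

lemma subset_Zariski_closure: "U \<subseteq> zero_locus (vanishing_ideal U)"
  by (auto simp: zero_locus_def vanishing_ideal_def)

lemma Zariski_closure_minimal:
  assumes "algebraic_set A" "U \<subseteq> A"
  shows "zero_locus (vanishing_ideal U) \<subseteq> A"
proof -
  obtain F where F: "F \<subseteq> poly_funs" "A = zero_locus F"
    using assms(1) by (auto simp: algebraic_set_def)
  then have "F \<subseteq> vanishing_ideal U"
    using assms(2) by (auto simp: zero_locus_def vanishing_ideal_def)
  then show ?thesis by (auto simp: F(2) zero_locus_def)
qed

text \<open>Intersecting the cover with \<open>Y\<close> turns the inclusion into an equation, the
  form in which irreducibility is defined.\<close>

lemma irreducible_set_subset_Un:
  assumes "irreducible_set Y" "algebraic_set A" "algebraic_set B" "Y \<subseteq> A \<union> B"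
  shows "Y \<subseteq> A \<or> Y \<subseteq> B"
proof -
  have "Y = (Y \<inter> A) \<union> (Y \<inter> B)" using assms(4) by blast
  moreover have "algebraic_set (Y \<inter> A)" "algebraic_set (Y \<inter> B)"
    using assms(1-3) by (simp_all add: irreducible_set_def algebraic_set_Int)
  ultimately have "Y \<inter> A = Y \<or> Y \<inter> B = Y"
    using assms(1) unfolding irreducible_set_def by blast
  then show ?thesis by blast
qed

text \<open>Supplies the upper bounds for Zorn's lemma. Each member of the chain lies in
  \<open>A\<close> or in \<open>B\<close>; as the members are nested, one of the two sets contains
  them all, hence also their closure.\<close>

lemma irreducible_set_closure_chain:
  assumes "subset.chain (Collect irreducible_set) C" "C \<noteq> {}"
  shows "irreducible_set (zero_locus (vanishing_ideal (\<Union>C)))" (is "irreducible_set ?Z")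
  unfolding irreducible_set_def
proof (intro conjI allI impI)
  have irr: "irreducible_set Y" if "Y \<in> C" for Y
    using assms(1) that by (auto simp: subset_chain_def)
  show "algebraic_set ?Z" by (rule algebraic_set_Zariski_closure)
  obtain Y where "Y \<in> C" "Y \<noteq> {}"
    using assms(2) irr by (auto simp: irreducible_set_def)
  then show "?Z \<noteq> {}" using subset_Zariski_closure[of "\<Union>C"] by blast
  fix A B assume AB: "algebraic_set A" "algebraic_set B" "?Z = A \<union> B"
  have sub: "Y \<subseteq> A \<or> Y \<subseteq> B" if "Y \<in> C" for Y
    using irreducible_set_subset_Un[OF irr[OF that] AB(1,2)] that
      subset_Zariski_closure[of "\<Union>C"] AB(3) by blast
  have "\<Union>C \<subseteq> A \<or> \<Union>C \<subseteq> B"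
  proof (rule ccontr)
    assume "\<not> ?thesis"
    then obtain Y Y' where Y: "Y \<in> C" "\<not> Y \<subseteq> A" "Y' \<in> C" "\<not> Y' \<subseteq> B" by blast
    \<comment> \<open>The larger of \<open>Y\<close> and \<open>Y'\<close> is contained neither in
      \<open>A\<close> nor in \<open>B\<close>, contrary to \<open>sub\<close>.\<close>
    moreover have "Y \<subseteq> Y' \<or> Y' \<subseteq> Y" using assms(1) Y by (auto simp: subset_chain_def)
    ultimately show False using sub[of Y] sub[of Y'] by blast
  qed
  then have "?Z \<subseteq> A \<or> ?Z \<subseteq> B" using Zariski_closure_minimal AB by blast
  then show "A = ?Z \<or> B = ?Z" using AB(3) by blast
qed

text \<open>Zorn's lemma, applied to the irreducible subsets of \<open>X\<close> through
  \<open>p\<close>, stands in for the Noetherian property of the Zariski topology.\<close>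

lemma irreducible_component_exists:
  assumes "algebraic_set X" "p \<in> X"
  obtains Y where "Y \<in> irreducible_components X" "p \<in> Y"
proof -
  let ?\<A> = "{Y. irreducible_set Y \<and> Y \<subseteq> X \<and> p \<in> Y}"
  have "\<exists>M\<in>?\<A>. \<forall>Z\<in>?\<A>. M \<subseteq> Z \<longrightarrow> Z = M"
  proof (rule subset_Zorn)
    fix C assume C: "subset.chain ?\<A> C"
    let ?Z = "zero_locus (vanishing_ideal (\<Union>C))"
    show "\<exists>U\<in>?\<A>. \<forall>Y\<in>C. Y \<subseteq> U"
    proof (cases "C = {}")
      case True
      \<comment> \<open>The empty chain is bounded by \<open>{p}\<close>, which also shows that the
        family is nonempty.\<close>
      then show ?thesis using irreducible_set_singleton[of p] assms(2) by blast
    next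
      case False
      have "subset.chain (Collect irreducible_set) C"
        using C by (auto simp: subset_chain_def)
      then have "irreducible_set ?Z" using False by (rule irreducible_set_closure_chain)
      moreover have "?Z \<subseteq> X"
        using C by (intro Zariski_closure_minimal[OF assms(1)]) (auto simp: subset_chain_def)
      moreover have "p \<in> ?Z" "\<forall>Y\<in>C. Y \<subseteq> ?Z"
        using C False subset_Zariski_closure[of "\<Union>C"] by (auto simp: subset_chain_def)
      ultimately show ?thesis by blast
    qed
  qed
  then obtain Y where Y: "Y \<in> ?\<A>" "\<forall>Z\<in>?\<A>. Y \<subseteq> Z \<longrightarrow> Z = Y"
    by (rule bexE)
  show ?thesis
  proof
    show "p \<in> Y" using Y(1) by simp
    \<comment> \<open>Any \<open>Z\<close> containing \<open>Y\<close> also contains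
      \<open>p\<close>, so maximality among the sets through \<open>p\<close> is maximality among
      all irreducible subsets of \<open>X\<close>.\<close>
    have "Z = Y" if "irreducible_set Z" "Y \<subseteq> Z" "Z \<subseteq> X" for Z
    proof -
      have "Z \<in> ?\<A>" using that \<open>p \<in> Y\<close> by auto
      then show ?thesis using Y(2) that(2) by simp
    qed
    then show "Y \<in> irreducible_components X" using Y(1) by (simp add: irreducible_components_def)
  qed
qed

text \<open>Purity makes every term of the supremum equal to \<open>k\<close>. Existence of a
  component through \<open>p\<close> keeps the supremum from being taken over the empty set, where
  it would be 0.\<close>

lemma local_dim_pure_dimensional:
  assumes "algebraic_set X" "pure_dimensional k X" "p \<in> X"
  shows "local_dim X p = enat k"
proof -
  obtain Y where "Y \<in> irreducible_components X" "p \<in> Y"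
    using irreducible_component_exists[OF assms(1,3)] by blast
  then have "alg_dim ` {Y \<in> irreducible_components X. p \<in> Y} = {enat k}"
    using assms(2) by (auto simp: pure_dimensional_def)
  then show ?thesis by (simp add: local_dim_def)
qed

section \<open>Tangent spaces as complex subspaces of dimension \<open>k\<close>\<close>

lemma poly_funs_has_derivative:
  assumes "f \<in> poly_funs"
  shows "\<exists>f'. (f has_derivative f') (at p) \<and> (\<forall>c v. f' (c *s v) = c * f' v)"
  \<comment> \<open>A Frechet derivative is a priori only real linear, so complex homogeneity is
    carried through the induction.\<close>
  using assms
proof induction
  case (const c)
  show ?case by (rule exI[of _ "\<lambda>_. 0"]) auto
next
  case (coord i)
  show ?case
    by (rule exI[of _ "\<lambda>v. v $ i"])
      (auto intro!: bounded_linear_imp_has_derivative bounded_linear_vec_nth)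
next
  case (add f g)
  then obtain f' g' where "(f has_derivative f') (at p)" "(g has_derivative g') (at p)"
    and *: "\<forall>c v. f' (c *s v) = c * f' v" "\<forall>c v. g' (c *s v) = c * g' v" by blast
  then have "((\<lambda>z. f z + g z) has_derivative (\<lambda>v. f' v + g' v)) (at p)"
    by (intro has_derivative_add)
  moreover have "\<forall>c v. f' (c *s v) + g' (c *s v) = c * (f' v + g' v)"
    using * by (simp add: distrib_left)
  ultimately show ?case by (intro exI[of _ "\<lambda>v. f' v + g' v"] conjI)
next
  case (mult f g)
  then obtain f' g' where "(f has_derivative f') (at p)" "(g has_derivative g') (at p)"
    and *: "\<forall>c v. f' (c *s v) = c * f' v" "\<forall>c v. g' (c *s v) = c * g' v" by blast
  then have "((\<lambda>z. f z * g z) has_derivative (\<lambda>v. f p * g' v + f' v * g p)) (at p)"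
    by (intro has_derivative_mult)
  moreover have "\<forall>c v. f p * g' (c *s v) + f' (c *s v) * g p = c * (f p * g' v + f' v * g p)"
    using * by (simp add: algebra_simps)
  ultimately show ?case by (intro exI[of _ "\<lambda>v. f p * g' v + f' v * g p"] conjI)
qed

lemma subspace_tangent_space: "vec.subspace (tangent_space X p)"
proof -
  have "frechet_derivative f (at p) 0 = 0 \<and>
      frechet_derivative f (at p) (u + v) =
        frechet_derivative f (at p) u + frechet_derivative f (at p) v \<and>
      frechet_derivative f (at p) (c *s u) = c * frechet_derivative f (at p) u"
    if f: "f \<in> poly_funs" for f u v c
  proof -
    obtain f' where f': "(f has_derivative f') (at p)" "\<forall>c v. f' (c *s v) = c * f' v"
      using poly_funs_has_derivative[OF f] by blast
    have "frechet_derivative f (at p) = f'" using frechet_derivative_at[OF f'(1)] by simp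
    moreover have "linear f'" using f'(1) by (rule has_derivative_linear)
    ultimately show ?thesis using f'(2) by (auto simp: linear_0 linear_add)
  qed
  then show ?thesis
    unfolding vec.subspace_def tangent_space_def vanishing_ideal_def by auto
qed

lemma dim_tangent_space:
  assumes "algebraic_set X" "pure_dimensional k X" "p \<in> X - Sing X"
  shows "vec.dim (tangent_space X p) = k"
  using assms local_dim_pure_dimensional[OF assms(1,2), of p] by (auto simp: Sing_def)

section \<open>Hermitian complements via real orthogonality\<close>

lemma scaleR_eq_smult: "r *\<^sub>R (v :: complex ^ 'm) = complex_of_real r *s v"
  by (simp add: vec_eq_iff complex_eq_iff)

lemma vec_subspace_imp_subspace:
  fixes W :: "(complex ^ 'm) set"
  shows "vec.subspace W \<Longrightarrow> subspace W"
  by (auto simp: subspace_def vec.subspace_def scaleR_eq_smult)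

lemma inner_eq_Re_hermitian_inner: "inner x y = Re (hermitian_inner x y)"
  by (simp add: inner_vec_def hermitian_inner_def inner_complex_def)

lemma hermitian_inner_smult_right: "hermitian_inner x (c *s y) = cnj c * hermitian_inner x y"
  by (simp add: hermitian_inner_def sum_distrib_left algebra_simps)

lemma hermitian_inner_smult_left: "hermitian_inner (c *s x) y = c * hermitian_inner x y"
  by (simp add: hermitian_inner_def sum_distrib_left algebra_simps)

lemma hermitian_inner_add_left:
  "hermitian_inner (x + x') y = hermitian_inner x y + hermitian_inner x' y"
  by (simp add: hermitian_inner_def sum.distrib distrib_right)

lemma hermitian_inner_zero_left: "hermitian_inner 0 y = 0"
  by (simp add: hermitian_inner_def)

lemma subspace_hermitian_complement: "vec.subspace (hermitian_complement W)"
  by (simp add: vec.subspace_def hermitian_complement_def hermitian_inner_add_left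
      hermitian_inner_smult_left hermitian_inner_zero_left)

text \<open>The real inner product only sees the real part of the Hermitian one. Since
  \<open>W\<close> is closed under multiplication by \<open>\<i>\<close>, testing against
  \<open>\<i> *s w\<close> recovers the imaginary part. Real orthogonal decomposition thus becomes
  available for \<open>W\<close>.\<close>

lemma hermitian_complement_eq_orthogonal:
  assumes "vec.subspace W"
  shows "hermitian_complement W = {x. \<forall>w\<in>W. orthogonal x w}"
proof (intro equalityI subsetI)
  fix x assume "x \<in> hermitian_complement W"
  then show "x \<in> {x. \<forall>w\<in>W. orthogonal x w}"
    by (simp add: hermitian_complement_def orthogonal_def inner_eq_Re_hermitian_inner)
next
  fix x assume "x \<in> {x. \<forall>w\<in>W. orthogonal x w}"
  then have Re0: "Re (hermitian_inner x w) = 0" if "w \<in> W" for w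
    using that by (simp add: orthogonal_def inner_eq_Re_hermitian_inner)
  have "hermitian_inner x w = 0" if "w \<in> W" for w
  proof -
    have "\<i> *s w \<in> W" using assms that by (simp add: vec.subspace_scale)
    from Re0[OF this] Re0[OF that] show ?thesis
      by (simp add: hermitian_inner_smult_right complex_eq_iff)
  qed
  then show "x \<in> hermitian_complement W" by (simp add: hermitian_complement_def)
qed

lemma hermitian_complement_Int:
  assumes "vec.subspace W"
  shows "hermitian_complement W \<inter> W = {0}"
proof -
  have "0 \<in> W" using assms by (rule vec.subspace_0)
  then show ?thesis
    unfolding hermitian_complement_eq_orthogonal[OF assms]
    by (auto simp: orthogonal_clauses orthogonal_self)
qed

lemma hermitian_complement_sum:
  assumes "vec.subspace W"
  obtains x y where "x \<in> hermitian_complement W" "y \<in> W" "z = x + y"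
proof -
  obtain y x where yx: "y \<in> span W" "\<And>w. w \<in> span W \<Longrightarrow> orthogonal x w" "z = y + x"
    using orthogonal_subspace_decomp_exists[of W z] by blast
  have "span W = W"
    using vec_subspace_imp_subspace[OF assms] by (simp add: span_eq_iff)
  then have "x \<in> hermitian_complement W" "y \<in> W"
    using yx(1,2) unfolding hermitian_complement_eq_orthogonal[OF assms] by blast+
  then show ?thesis using that yx(3) by (simp add: add.commute)
qed

lemma dim_hermitian_complement:
  fixes W :: "(complex ^ 'm) set"
  assumes "vec.subspace W"
  shows "vec.dim (hermitian_complement W) + vec.dim W = CARD('m)"
proof -
  have "{x + y |x y. x \<in> hermitian_complement W \<and> y \<in> W} = UNIV"
    using hermitian_complement_sum[OF assms] by blast
  then show ?thesis
    using vec.dim_sums_Int[OF subspace_hermitian_complement[of W] assms]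
    by (simp add: hermitian_complement_Int[OF assms] card_cart_basis)
qed

section \<open>The projection along \<open>W\<close>: linearity and derivative\<close>

lemma proj_along_add:
  assumes "vec.subspace V" "vec.subspace W" "V \<inter> W = {0}" "x \<in> V" "y \<in> W"
  shows "proj_along V W (x + y) = x"
  unfolding proj_along_def
proof (rule the_equality)
  show "x \<in> V \<and> (\<exists>y'\<in>W. x + y = x + y')" using assms by blast
next
  fix x' assume "x' \<in> V \<and> (\<exists>y'\<in>W. x + y = x' + y')"
  then obtain y' where *: "x' \<in> V" "y' \<in> W" "x + y = x' + y'" by blast
  \<comment> \<open>Two decompositions of the same vector differ by an element of
    \<open>V \<inter> W\<close>, which is zero.\<close>
  then have "x' - x = y - y'" by (simp add: algebra_simps)
  moreover have "x' - x \<in> V" "y - y' \<in> W" using assms * by (auto intro: vec.subspace_diff)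
  ultimately have "x' - x \<in> V \<inter> W" by simp
  then show "x' = x" using assms(3) by simp
qed

lemma linear_proj_along_hermitian_complement:
  assumes "vec.subspace W"
  shows "Vector_Spaces.linear (*s) (*s) (proj_along (hermitian_complement W) W)"
    (is "Vector_Spaces.linear _ _ ?\<pi>")
proof -
  note V = subspace_hermitian_complement[of W]
  note proj = proj_along_add[OF V assms hermitian_complement_Int[OF assms]]
  have "?\<pi> (z + z') = ?\<pi> z + ?\<pi> z'" for z z'
  proof -
    obtain x y x' y' where *: "x \<in> hermitian_complement W" "y \<in> W" "z = x + y"
      "x' \<in> hermitian_complement W" "y' \<in> W" "z' = x' + y'"
      using hermitian_complement_sum[OF assms, of z] hermitian_complement_sum[OF assms, of z']
      by metis
    have "z + z' = (x + x') + (y + y')" using * by (simp add: algebra_simps)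
    then show ?thesis
      using * proj[of "x + x'" "y + y'"] V assms
      by (metis proj vec.subspace_add)
  qed
  moreover have "?\<pi> (c *s z) = c *s ?\<pi> z" for c z
  proof -
    obtain x y where *: "x \<in> hermitian_complement W" "y \<in> W" "z = x + y"
      using hermitian_complement_sum[OF assms, of z] by metis
    then show ?thesis
      using proj[of "c *s x" "c *s y"] V assms
      by (simp add: proj vec.subspace_scale vec.scale_right_distrib)
  qed
  ultimately show ?thesis
    by (simp add: Vector_Spaces.linear_iff vec.vector_space_axioms)
qed

lemma linear_imp_real_linear:
  fixes f :: "complex ^ 'm \<Rightarrow> complex ^ 'n"
  assumes "Vector_Spaces.linear (*s) (*s) f"
  shows "linear f"
  using assms by (intro linearI) (auto simp: Vector_Spaces.linear_iff scaleR_eq_smult)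

lemma frechet_derivative_linear:
  fixes f :: "'a::euclidean_space \<Rightarrow> 'b::real_normed_vector"
  assumes "linear f"
  shows "frechet_derivative f (at p) = f"
  using frechet_derivative_at[OF bounded_linear_imp_has_derivative] assms
  by (metis linear_conv_bounded_linear)

section \<open>Kernel vectors of a degenerate projection and their limits\<close>

lemma linear_bij_betw_if_kernel_trivial:
  assumes lin: "Vector_Spaces.linear (*s) (*s) f"
    and T: "vec.subspace T" and V: "vec.subspace V" and dim: "vec.dim T = vec.dim V"
    and into: "f ` T \<subseteq> V" and ker: "\<And>u. u \<in> T \<Longrightarrow> f u = 0 \<Longrightarrow> u = 0"
  shows "bij_betw f T V"
proof -
  have inj: "inj_on f T"
  proof (rule inj_onI)
    fix u v assume "u \<in> T" "v \<in> T" "f u = f v"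
    then have "u - v = 0"
      using ker[of "u - v"] T by (auto simp: vec.linear_diff[OF lin] vec.subspace_diff)
    then show "u = v" by simp
  qed
  \<comment> \<open>An injective linear map preserves dimension, so the image is a subspace of
    \<open>V\<close> of full dimension.\<close>
  moreover have "f ` T = V"
  proof (rule vec.subspace_dim_equal[OF _ V into])
    show "vec.subspace (f ` T)" using vec.linear_subspace_image[OF lin T] .
    have "vec.span T = T" using T by simp
    then show "vec.dim V \<le> vec.dim (f ` T)"
      using vec.dim_image_eq[OF lin, of T] inj dim by (metis order_refl)
  qed
  ultimately show ?thesis by (simp add: bij_betw_def)
qed

lemma unit_vector_if_not_bij_betw:
  fixes W :: "(complex ^ 'm) set"
  assumes W: "vec.subspace W" and T: "vec.subspace T"
    and dim: "vec.dim W + vec.dim T = CARD('m)"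
    and not_bij: "\<not> bij_betw (proj_along (hermitian_complement W) W) T (hermitian_complement W)"
  obtains u where "u \<in> T" "u \<in> W" "norm u = 1"
proof -
  let ?V = "hermitian_complement W" and ?\<pi> = "proj_along (hermitian_complement W) W"
  note proj = proj_along_add[OF subspace_hermitian_complement W hermitian_complement_Int[OF W]]
  \<comment> \<open>Write \<open>z = x + y\<close> with \<open>x\<close> in the complement and
    \<open>y\<close> in \<open>W\<close>; then the projection of \<open>z\<close> is
    \<open>x\<close>, and \<open>x = 0\<close> leaves \<open>z = y\<close>.\<close>
  have into: "?\<pi> z \<in> ?V" and ker: "?\<pi> z = 0 \<Longrightarrow> z \<in> W" for z
    using hermitian_complement_sum[OF W, of z] proj by (metis, metis add.left_neutral)
  obtain v where v: "v \<in> T" "?\<pi> v = 0" "v \<noteq> 0"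
    using linear_bij_betw_if_kernel_trivial[OF linear_proj_along_hermitian_complement[OF W] T
        subspace_hermitian_complement, of W] dim_hermitian_complement[OF W] dim into not_bij
    by fastforce
  show ?thesis
  proof
    show "sgn v \<in> T" "sgn v \<in> W"
      using v T W ker by (auto simp: sgn_div_norm scaleR_eq_smult vec.subspace_scale)
    show "norm (sgn v) = 1" using v by (simp add: norm_sgn)
  qed
qed

text \<open>The unit sphere of \<open>W\<close> is compact, so a subsequence of the
  \<open>u j\<close> converges in it. The corresponding base points still tend to infinity, and the
  limit keeps norm 1, hence is nonzero.\<close>

lemma unit_vectors_limit:
  assumes p: "\<And>j. p j \<in> X - Sing X" "filterlim (\<lambda>j. norm (p j)) at_top sequentially"
    and u: "\<And>j. u j \<in> tangent_space X (p j)" "\<And>j. u j \<in> W" "\<And>j. norm (u j) = 1"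
    and W: "vec.subspace W"
  shows "\<exists>v. v \<in> C4_inf X \<inter> W \<and> norm v = 1"
proof -
  have "compact (sphere 0 1 \<inter> W)"
    using closed_subspace[OF vec_subspace_imp_subspace[OF W]] by (intro compact_Int_closed) auto
  moreover have "\<forall>j. u j \<in> sphere 0 1 \<inter> W" using u by auto
  ultimately obtain v r where v: "v \<in> sphere 0 1 \<inter> W" "strict_mono r" "(u \<circ> r) \<longlonglongrightarrow> v"
    unfolding compact_def by metis
  have "filterlim (\<lambda>j. norm ((p \<circ> r) j)) at_top sequentially"
    using filterlim_compose[OF p(2) filterlim_subseq[OF v(2)]] by (simp add: o_def)
  then have "v \<in> C4_inf X"
    unfolding C4_inf_def using p(1) u(1) v(3)
    by (intro CollectI exI[of _ "p \<circ> r"] exI[of _ "u \<circ> r"]) auto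
  with v(1) show ?thesis by auto
qed

theorem theorem1p2:
  fixes X W V :: "(complex ^ 'm) set"
    and \<pi> :: "complex ^ 'm \<Rightarrow> complex ^ 'm"
    and k :: nat
  assumes "algebraic_set X"
    and "\<not> bounded X"
    and "pure_dimensional k X"
    and "vec.subspace W"
    and "vec.dim W + k = CARD('m)"
    and "W \<inter> C3_inf X = {0}"
    and "V = hermitian_complement W"
    and "\<pi> = proj_along V W"
    and "C4_inf X \<inter> W = {0}"
  shows "\<exists>R>0. Sing X - cball 0 R = Sing_map X V \<pi> - cball 0 R"
proof (rule ccontr)
  assume "\<not> ?thesis"
  then have neq: "Sing X - cball 0 R \<noteq> Sing_map X V \<pi> - cball 0 R" if "R > 0" for R
    using that by blast
  \<comment> \<open>A linear map is its own derivative, so being critical at \<open>p\<close>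
    becomes a condition on \<open>\<pi>\<close> restricted to the tangent space.\<close>
  have "linear \<pi>"
    using linear_imp_real_linear[OF linear_proj_along_hermitian_complement] assms(4,7,8) by simp
  then have d\<pi>: "frechet_derivative \<pi> (at p) = \<pi>" for p
    by (rule frechet_derivative_linear)
  have "\<exists>p u. p \<in> X - Sing X \<and> real (Suc j) \<le> norm p \<and>
      u \<in> tangent_space X p \<and> u \<in> W \<and> norm u = 1" for j
  proof -
    obtain p where p: "p \<in> X - Sing X" "real (Suc j) \<le> norm p"
        "\<not> bij_betw \<pi> (tangent_space X p) V"
      \<comment> \<open>\<open>Suc j\<close> makes the radius positive also for
        \<open>j = 0\<close>. As \<open>Sing X\<close> is contained in
        \<open>Sing_map X V \<pi>\<close>, the two sets can only differ by a regular point of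
        \<open>X\<close> that is critical for \<open>\<pi>\<close>.\<close>
      using neq[of "real (Suc j)"] by (force simp: Sing_map_def d\<pi>)
    have "vec.dim W + vec.dim (tangent_space X p) = CARD('m)"
      using dim_tangent_space[OF assms(1,3) p(1)] assms(5) by simp
    then obtain u where "u \<in> tangent_space X p" "u \<in> W" "norm u = 1"
      using unit_vector_if_not_bij_betw[OF assms(4) subspace_tangent_space] p(3) assms(7,8)
      by blast
    with p show ?thesis by blast
  qed
  then obtain p u where pu: "\<And>j. p j \<in> X - Sing X" "\<And>j. real (Suc j) \<le> norm (p j)"
      "\<And>j. u j \<in> tangent_space X (p j)" "\<And>j. u j \<in> W" "\<And>j. norm (u j) = 1"
    by metis
  have "filterlim (\<lambda>j. real (Suc j)) at_top sequentially"
    using filterlim_compose[OF filterlim_real_sequentially filterlim_Suc] .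
  then have "filterlim (\<lambda>j. norm (p j)) at_top sequentially"
    by (rule filterlim_at_top_mono) (use pu(2) in auto)
  from unit_vectors_limit[OF pu(1) this pu(3-5) assms(4)] obtain v
    where "v \<in> C4_inf X \<inter> W" "norm v = 1" by blast
  with assms(9) show False by auto
qed

end
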